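(* Let $f(t)=\sum_{m=0}^{\infty}a_m t^m$ be a formal power series with complex coefficients and let $x,y,z$ be indeterminates. Then, as identities of formal power series in $x,y,z$, $$\sum_{n=0}^{\infty}x^n\left\{\sum_{k=0}^n\binom{n}{k}(-1)^k f(y+zk)\right\} = \sum_{m=0}^{\infty}a_m\left\{\sum_{p=0}^m\binom{m}{p}z^p y^{m-p}\omega_p(-x)\right\},$$ and, in the case $y=0$, $$\sum_{n=0}^{\infty}x^n\left\{\sum_{k=0}^n\binom{n}{k}(-1)^k f(zk)\right\} = \sum_{m=0}^{\infty}a_m z^m\omega_m(-x).$$
   Context: $S(m,n)$ denotes the Stirling numbers of the second kind, $S(m,n)=\frac{(-1)^n}{n!}\sum_{k=0}^n\binom{n}{k}(-1)^k k^m$. The geometric polynomials are $\omega_m(x)=\sum_{n=0}^m S(m,n)\,n!\,x^n$ for $m\ge 0$. *)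

theory Defs
  imports "HOL-Combinatorics.Stirling" "HOL-Computational_Algebra.Computational_Algebra"
begin

text \<open>
  The ring of formal power series in three indeterminates is represented as the iterated ring
  \<open>\<complex>[[z]][[y]][[x]]\<close>: \<open>x\<close> is the outermost and \<open>z\<close> the innermost indeterminate.
\<close>

type_synonym fps3 = "complex fps fps fps"

definition const3 :: "complex \<Rightarrow> fps3" where
  "const3 c = fps_const (fps_const (fps_const c))"

definition var_x :: fps3 where "var_x = fps_X"
definition var_y :: fps3 where "var_y = fps_const fps_X"
definition var_z :: fps3 where "var_z = fps_const (fps_const fps_X)"

definition coeff3 :: "fps3 \<Rightarrow> nat \<Rightarrow> nat \<Rightarrow> nat \<Rightarrow> complex" where
  "coeff3 F i j k = fps_nth (fps_nth (fps_nth F i) j) k"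

text \<open>
  Convergence of an infinite series in \<open>\<complex>[[x,y,z]]\<close>: every coefficient of the partial sums is
  eventually constant. The library topology on the type \<^typ>\<open>complex fps fps fps\<close> cannot be used
  here, since it is adic with respect to the outermost indeterminate only.
\<close>

definition fps3_sums :: "(nat \<Rightarrow> fps3) \<Rightarrow> fps3 \<Rightarrow> bool" where
  "fps3_sums F S \<longleftrightarrow>
     (\<forall>i j k. \<forall>\<^sub>F N in sequentially. coeff3 (\<Sum>n<N. F n) i j k = coeff3 S i j k)"

definition fps3_summable :: "(nat \<Rightarrow> fps3) \<Rightarrow> bool" where
  "fps3_summable F \<longleftrightarrow> (\<exists>S. fps3_sums F S)"

definition fps3_suminf :: "(nat \<Rightarrow> fps3) \<Rightarrow> fps3" where
  "fps3_suminf F = (THE S. fps3_sums F S)"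

lemma fps3_sums_unique:
  assumes "fps3_sums F S" "fps3_sums F T"
  shows "S = T"
proof -
  have "coeff3 S i j k = coeff3 T i j k" for i j k
  proof -
    have "\<forall>\<^sub>F N in sequentially. coeff3 (\<Sum>n<N. F n) i j k = coeff3 S i j k"
      "\<forall>\<^sub>F N in sequentially. coeff3 (\<Sum>n<N. F n) i j k = coeff3 T i j k"
      using assms by (auto simp: fps3_sums_def)
    then have "\<forall>\<^sub>F N in sequentially. coeff3 S i j k = coeff3 T i j k"
      by eventually_elim simp
    then show ?thesis by simp
  qed
  then show ?thesis by (simp add: fps_eq_iff coeff3_def)
qed

lemma fps3_suminf_eq: "fps3_sums F S \<Longrightarrow> fps3_suminf F = S"
  unfolding fps3_suminf_def by (blast intro: fps3_sums_unique)

text \<open>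
  The family of terms \<open>a\<^sub>m g\<^sup>m\<close> and its sum \<open>f(g)\<close>; the latter is meaningful when the
  family is summable, e.g. if \<open>g\<close> has zero constant term.
\<close>

definition subst_terms :: "complex fps \<Rightarrow> fps3 \<Rightarrow> nat \<Rightarrow> fps3" where
  "subst_terms f g m = const3 (fps_nth f m) * g ^ m"

definition fps3_subst :: "complex fps \<Rightarrow> fps3 \<Rightarrow> fps3" where
  "fps3_subst f g = fps3_suminf (subst_terms f g)"

definition geometric_poly :: "nat \<Rightarrow> 'a::comm_ring_1 poly" where
  "geometric_poly m = (\<Sum>n\<le>m. monom (of_nat (Stirling m n * fact n)) n)"

lemma poly_geometric_poly:
  "poly (geometric_poly m) x = (\<Sum>n\<le>m. of_nat (Stirling m n) * fact n * x ^ n)"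
  by (simp add: geometric_poly_def poly_sum poly_monom)

lemma Stirling_explicit:
  "(of_nat (Stirling m n) :: 'a::field_char_0) =
     (-1) ^ n / fact n * (\<Sum>k\<le>n. of_nat (n choose k) * (-1) ^ k * of_nat k ^ m)"
proof -
  define T :: "nat \<Rightarrow> nat \<Rightarrow> 'a"
    where "T m n = (\<Sum>k\<le>n. of_nat (n choose k) * (-1) ^ k * of_nat k ^ m)" for m n
  have T_Suc: "T (Suc m) (Suc n) = of_nat (Suc n) * (T m (Suc n) - T m n)" for m n
  proof -
    have absorb: "of_nat k * of_nat (Suc n choose k) =
        (of_nat (Suc n) * (of_nat (Suc n choose k) - of_nat (n choose k)) :: 'a)" for k
    proof (cases k)
      case (Suc j)
      have "of_nat (Suc j * (Suc n choose Suc j)) = (of_nat (Suc n * (n choose j)) :: 'a)"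
        by (simp only: Suc_times_binomial_eq mult.commute)
      then show ?thesis using Suc by (simp add: algebra_simps)
    qed simp
    have "T m n = (\<Sum>k\<le>Suc n. of_nat (n choose k) * (-1) ^ k * of_nat k ^ m)"
      by (simp add: T_def)
    then have "of_nat (Suc n) * (T m (Suc n) - T m n) =
      (\<Sum>k\<le>Suc n. of_nat (Suc n) * (of_nat (Suc n choose k) - of_nat (n choose k))
          * ((-1) ^ k * of_nat k ^ m))"
      unfolding T_def[of m "Suc n"]
      by (simp only: sum_subtractf[symmetric] sum_distrib_left algebra_simps)
    also have "\<dots> = T (Suc m) (Suc n)"
      unfolding T_def absorb[symmetric] by (intro sum.cong) (auto simp: mult_ac)
    finally show ?thesis by simp
  qed
  have T_0: "T 0 n = (if n = 0 then 1 else 0)" for n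
    using choose_alternating_sum[of n, where 'a='a] 
    by (cases "n = 0") (auto simp: T_def mult_ac)
  have "of_nat (Stirling m n) = (-1) ^ n / fact n * T m n"
  proof (induction m arbitrary: n)
    case 0
    then show ?case by (cases n) (auto simp: T_0)
  next
    case (Suc m)
    show ?case
    proof (cases n)
      case 0
      then show ?thesis by (simp add: T_def)
    next
      case n: (Suc l)
      have nz: "(of_nat (Suc l) :: 'a) \<noteq> 0" by (rule of_nat_neq_0)
      have "of_nat (Stirling (Suc m) n) =
          of_nat (Suc l) * ((-1) ^ Suc l / fact (Suc l) * T m (Suc l)) + (-1) ^ l / fact l * T m l"
        by (simp only: n Stirling.simps of_nat_add of_nat_mult Suc.IH)
      also have "\<dots> = (-1) ^ n / fact n * T (Suc m) n"
        using nz unfolding n T_Suc fact_Suc by (simp add: field_simps del: of_nat_Suc)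
      finally show ?thesis .
    qed
  qed
  then show ?thesis by (simp add: T_def)
qed

end

theory Submission
  imports Defs
begin

text \<open>
  Grade \<open>\<complex>[[x,y,z]]\<close> by the total degree in \<open>y\<close> and \<open>z\<close>. The degree \<open>m\<close> part of \<open>f(w + zk)\<close>, with
  \<open>w\<close> of degree 1, is \<open>a\<^sub>m (w + zk)\<^sup>m\<close>, so both sides can be compared degree by degree. In each
  degree the claim is a finite identity: expand \<open>(w + zk)\<^sup>m\<close> binomially and evaluate the alternating
  sums over \<open>k\<close> by the explicit formula for the Stirling numbers, which vanish for \<open>n > m\<close>.
  Taking \<open>w = y\<close> and \<open>w = 0\<close> gives the two statements.
\<close>

text \<open>The exponent \<open>i\<close> of x is left free, so that x, and with it the values of
  \<open>geometric_poly\<close> at \<open>- var_x\<close>, counts as a scalar of degree 0. The zero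
  series has every degree, which later admits \<open>w = 0\<close> as a form of degree 1.\<close>

definition yz_homogeneous :: "nat \<Rightarrow> fps3 \<Rightarrow> bool" where
  "yz_homogeneous d F \<longleftrightarrow> (\<forall>i j k. j + k \<noteq> d \<longrightarrow> coeff3 F i j k = 0)"

lemma coeff3_sum: "coeff3 (\<Sum>a\<in>A. F a) i j k = (\<Sum>a\<in>A. coeff3 (F a) i j k)"
  by (simp add: coeff3_def fps_sum_nth)

lemma coeff3_const3_mult: "coeff3 (const3 c * F) i j k = c * coeff3 F i j k"
  by (simp add: coeff3_def const3_def)

lemma coeff3_var_x_power_mult:
  "coeff3 (var_x ^ n * F) i j k = (if i < n then 0 else coeff3 F (i - n) j k)"
  by (simp add: coeff3_def var_x_def fps_X_power_mult_nth)

text \<open>Brings the signed binomial coefficients into the shape in which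
  \<open>coeff3_const3_mult\<close> can pull them out of a coefficient.\<close>

lemma of_nat_mult_minus_one_power_eq_const3:
  "of_nat c * (-1) ^ k = const3 (of_nat c * (-1) ^ k)"
proof -
  have "(-1 :: fps3) ^ k = const3 ((-1) ^ k)"
    by (cases "even k") (simp_all add: const3_def flip: fps_const_neg)
  moreover have "(of_nat c :: fps3) = const3 (of_nat c)"
    by (simp add: const3_def fps_of_nat)
  ultimately show ?thesis
    by (simp add: const3_def)
qed

lemma yz_homogeneous_0 [simp]: "yz_homogeneous d 0"
  by (simp add: yz_homogeneous_def coeff3_def)

lemma yz_homogeneous_const3: "yz_homogeneous 0 (const3 c)"
  by (auto simp: yz_homogeneous_def coeff3_def const3_def)

lemma yz_homogeneous_of_nat: "yz_homogeneous 0 (of_nat n)"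
  using yz_homogeneous_const3[of "of_nat n"] by (simp add: const3_def fps_of_nat)

lemma yz_homogeneous_var_x: "yz_homogeneous 0 var_x"
  by (auto simp: yz_homogeneous_def coeff3_def var_x_def fps_X_def)

lemma yz_homogeneous_var_y: "yz_homogeneous 1 var_y"
  by (auto simp: yz_homogeneous_def coeff3_def var_y_def fps_X_def)

lemma yz_homogeneous_var_z: "yz_homogeneous 1 var_z"
  by (auto simp: yz_homogeneous_def coeff3_def var_z_def fps_X_def)

lemma yz_homogeneous_uminus: "yz_homogeneous d F \<Longrightarrow> yz_homogeneous d (- F)"
  by (simp add: yz_homogeneous_def coeff3_def)

lemma yz_homogeneous_add:
  "yz_homogeneous d F \<Longrightarrow> yz_homogeneous d G \<Longrightarrow> yz_homogeneous d (F + G)"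
  by (simp add: yz_homogeneous_def coeff3_def)

lemma yz_homogeneous_sum:
  "(\<And>a. a \<in> A \<Longrightarrow> yz_homogeneous d (F a)) \<Longrightarrow> yz_homogeneous d (\<Sum>a\<in>A. F a)"
  by (induction A rule: infinite_finite_induct) (auto intro: yz_homogeneous_add)

lemma yz_homogeneous_mult:
  assumes "yz_homogeneous d F" "yz_homogeneous e G"
  shows "yz_homogeneous (d + e) (F * G)"
  unfolding yz_homogeneous_def
proof (intro allI impI)
  fix i j k :: nat
  assume deg: "j + k \<noteq> d + e"
  have "coeff3 (F * G) i j k = (\<Sum>a = 0..i. \<Sum>b = 0..j. \<Sum>c = 0..k.
      coeff3 F a b c * coeff3 G (i - a) (j - b) (k - c))"
    by (simp add: coeff3_def fps_mult_nth fps_sum_nth)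
  also have "\<dots> = 0"
  proof (intro sum.neutral ballI)
    fix a b c
    assume "a \<in> {0..i}" "b \<in> {0..j}" "c \<in> {0..k}"
    \<comment> \<open>Since \<open>b \<le> j\<close> and \<open>c \<le> k\<close>, the subtractions
      are exact and the two degrees add up to \<open>j + k\<close>; hence one factor is off its
      degree and its coefficient vanishes.\<close>
    with deg have "b + c \<noteq> d \<or> (j - b) + (k - c) \<noteq> e" by auto
    with assms show "coeff3 F a b c * coeff3 G (i - a) (j - b) (k - c) = 0"
      by (auto simp: yz_homogeneous_def)
  qed
  finally show "coeff3 (F * G) i j k = 0" .
qed

lemma yz_homogeneous_power: "yz_homogeneous d F \<Longrightarrow> yz_homogeneous (n * d) (F ^ n)"
proof (induction n)
  case 0
  show ?case using yz_homogeneous_of_nat[of 1] by simp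
next
  case (Suc n)
  then show ?case using yz_homogeneous_mult[of d F "n * d" "F ^ n"] by simp
qed

lemma yz_homogeneous_mult_degree_0:
  "yz_homogeneous 0 F \<Longrightarrow> yz_homogeneous d G \<Longrightarrow> yz_homogeneous d (F * G)"
  using yz_homogeneous_mult[of 0 F d G] by simp

lemma yz_homogeneous_power_degree_1: "yz_homogeneous 1 F \<Longrightarrow> yz_homogeneous n (F ^ n)"
  using yz_homogeneous_power[of 1 F n] by simp

lemma yz_homogeneous_poly_geometric_poly:
  assumes "yz_homogeneous 0 F"
  shows "yz_homogeneous 0 (poly (geometric_poly p) F)"
proof -
  have "yz_homogeneous 0 (of_nat (Stirling p n * fact n) * F ^ n)" for n
    using assms yz_homogeneous_power[of 0 F n]
    by (intro yz_homogeneous_mult_degree_0 yz_homogeneous_of_nat) simp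
  then show ?thesis
    unfolding geometric_poly_def poly_sum poly_monom by (rule yz_homogeneous_sum)
qed

text \<open>If each \<open>F m\<close> is homogeneous of degree \<open>m\<close>, only the member
  with index \<open>j + k\<close> can contribute to the coefficient at the exponents
  \<open>j\<close> of y and \<open>k\<close> of z. This gives the infinite sum in closed form,
  without a limit.\<close>

definition yz_graded_sum :: "(nat \<Rightarrow> fps3) \<Rightarrow> fps3" where
  "yz_graded_sum F = Abs_fps (\<lambda>i. Abs_fps (\<lambda>j. Abs_fps (\<lambda>k. coeff3 (F (j + k)) i j k)))"

lemma coeff3_yz_graded_sum: "coeff3 (yz_graded_sum F) i j k = coeff3 (F (j + k)) i j k"
  by (simp add: yz_graded_sum_def coeff3_def)

lemma fps3_sums_yz_graded_sum:
  assumes "\<And>m. yz_homogeneous m (F m)"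
  shows "fps3_sums F (yz_graded_sum F)"
  unfolding fps3_sums_def
proof (intro allI)
  fix i j k
  have "coeff3 (\<Sum>n<N. F n) i j k = coeff3 (yz_graded_sum F) i j k" if "N > j + k" for N
  proof -
    have "coeff3 (\<Sum>n<N. F n) i j k = (\<Sum>n<N. if n = j + k then coeff3 (F n) i j k else 0)"
      unfolding coeff3_sum using assms by (intro sum.cong) (auto simp: yz_homogeneous_def)
    with that show ?thesis by (simp add: coeff3_yz_graded_sum)
  qed
  then show "\<forall>\<^sub>F N in sequentially. coeff3 (\<Sum>n<N. F n) i j k = coeff3 (yz_graded_sum F) i j k"
    using eventually_gt_at_top[of "j + k"] by (rule eventually_mono[rotated])
qed

lemma fps3_sums_subst_terms:
  assumes "yz_homogeneous 1 g"
  shows "fps3_sums (subst_terms f g) (yz_graded_sum (subst_terms f g))"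
  using assms unfolding subst_terms_def
  by (intro fps3_sums_yz_graded_sum yz_homogeneous_mult_degree_0 yz_homogeneous_const3
      yz_homogeneous_power_degree_1)

text \<open>The power \<open>g ^ m\<close> has degree \<open>m\<close>, so a coefficient of f(g)
  sees a single term of the series. This reduces the theorem to finite sums.\<close>

lemma coeff3_fps3_subst:
  assumes "yz_homogeneous 1 g"
  shows "coeff3 (fps3_subst f g) i j k = coeff3 (subst_terms f g (j + k)) i j k"
  by (simp add: fps3_subst_def fps3_suminf_eq[OF fps3_sums_subst_terms[OF assms]]
      coeff3_yz_graded_sum)

text \<open>\<open>Stirling_explicit\<close> divides by n! and so lives in a field of characteristic
  0, while the identity is to be used in the ring of power series. Both sides are integers: the
  identity is proved in the complex numbers, pulled back along the injective \<open>of_int\<close>,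
  and then mapped into an arbitrary commutative ring.\<close>

lemma alternating_binomial_sum_power:
  "(\<Sum>k\<le>n. of_nat (n choose k) * (-1) ^ k * of_nat k ^ p :: 'a::comm_ring_1) =
     (-1) ^ n * of_nat (Stirling p n * fact n)"
proof -
  have "(of_int (\<Sum>k\<le>n. of_nat (n choose k) * (-1) ^ k * of_nat k ^ p) :: complex) =
      of_int ((-1) ^ n * of_nat (Stirling p n * fact n))"
    by (simp add: Stirling_explicit[of p n] flip: mult.assoc power_add)
  then have "(\<Sum>k\<le>n. of_nat (n choose k) * (-1) ^ k * of_nat k ^ p :: int) =
      (-1) ^ n * of_nat (Stirling p n * fact n)"
    by (simp only: of_int_eq_iff)
  from arg_cong[OF this, of "of_int :: int \<Rightarrow> 'a"] show ?thesis
    by (simp del: of_nat_mult of_nat_fact)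
qed

text \<open>After binomial expansion the sums over \<open>k\<close> become Stirling numbers
  \<open>Stirling p n\<close> with \<open>p \<le> m\<close>. These vanish for \<open>n > p\<close>,
  so every cut-off \<open>N > m\<close> already yields the full geometric polynomials.\<close>

lemma sum_alternating_binomial_power_eq_geometric_poly:
  fixes w x z :: "'a::comm_ring_1"
  assumes "m < N"
  shows "(\<Sum>n<N. x ^ n * (\<Sum>k\<le>n. of_nat (n choose k) * (-1) ^ k * (w + z * of_nat k) ^ m)) =
    (\<Sum>p\<le>m. of_nat (m choose p) * z ^ p * w ^ (m - p) * poly (geometric_poly p) (- x))"
proof -
  have inner: "(\<Sum>k\<le>n. of_nat (n choose k) * (-1) ^ k * (w + z * of_nat k) ^ m) =
      (\<Sum>p\<le>m. of_nat (m choose p) * z ^ p * w ^ (m - p) *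
        ((-1) ^ n * of_nat (Stirling p n * fact n)))" for n
  proof -
    have "(\<Sum>k\<le>n. of_nat (n choose k) * (-1) ^ k * (w + z * of_nat k) ^ m) =
        (\<Sum>k\<le>n. \<Sum>p\<le>m. of_nat (m choose p) * z ^ p * w ^ (m - p) *
          (of_nat (n choose k) * (-1) ^ k * of_nat k ^ p))"
      by (simp add: add.commute[of w] binomial_ring sum_distrib_left power_mult_distrib mult_ac)
    also have "\<dots> = (\<Sum>p\<le>m. of_nat (m choose p) * z ^ p * w ^ (m - p) *
        (\<Sum>k\<le>n. of_nat (n choose k) * (-1) ^ k * of_nat k ^ p))"
      by (subst sum.swap) (simp only: sum_distrib_left)
    finally show ?thesis by (simp only: alternating_binomial_sum_power)
  qed
  have geom: "(\<Sum>n<N. x ^ n * ((-1) ^ n * of_nat (Stirling p n * fact n))) =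
      poly (geometric_poly p) (- x)" if "p \<le> m" for p
  proof -
    \<comment> \<open>From \<open>p \<le> m < N\<close>, the range up to \<open>p\<close> lies below
      the cut-off, and the terms beyond \<open>p\<close> are zero.\<close>
    have "(\<Sum>n<N. x ^ n * ((-1) ^ n * of_nat (Stirling p n * fact n))) =
        (\<Sum>n\<le>p. x ^ n * ((-1) ^ n * of_nat (Stirling p n * fact n)))"
      using assms that by (intro sum.mono_neutral_right) auto
    also have "\<dots> = poly (geometric_poly p) (- x)"
      unfolding geometric_poly_def poly_sum poly_monom
      by (intro sum.cong refl) (simp only: power_minus[of x] mult_ac)
    finally show ?thesis .
  qed
  have "(\<Sum>n<N. x ^ n * (\<Sum>k\<le>n. of_nat (n choose k) * (-1) ^ k * (w + z * of_nat k) ^ m)) =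
      (\<Sum>p\<le>m. of_nat (m choose p) * z ^ p * w ^ (m - p) *
        (\<Sum>n<N. x ^ n * ((-1) ^ n * of_nat (Stirling p n * fact n))))"
    unfolding inner sum_distrib_left by (subst sum.swap) (simp only: mult_ac)
  then show ?thesis using geom by simp
qed

text \<open>Both series are shown to converge to the same \<open>yz_graded_sum R\<close>, so their
  sums agree. The terms of the series in powers of x are in general not homogeneous, so its
  convergence is checked coefficient by coefficient.\<close>

lemma fps3_sums_geometric_poly:
  fixes f :: "complex fps"
  assumes w: "yz_homogeneous 1 w"
  defines "R \<equiv> \<lambda>m. const3 (fps_nth f m) *
    (\<Sum>p\<le>m. of_nat (m choose p) * var_z ^ p * w ^ (m - p) * poly (geometric_poly p) (- var_x))"
  shows "fps3_summable (subst_terms f (w + var_z * of_nat k))"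
    and "fps3_sums R (yz_graded_sum R)"
    and "fps3_sums (\<lambda>n. var_x ^ n *
      (\<Sum>k\<le>n. of_nat (n choose k) * (-1) ^ k * fps3_subst f (w + var_z * of_nat k)))
      (yz_graded_sum R)"
proof -
  have g: "yz_homogeneous 1 (w + var_z * of_nat k)" for k
    using yz_homogeneous_mult_degree_0[OF yz_homogeneous_of_nat yz_homogeneous_var_z, of k]
    by (intro yz_homogeneous_add w) (simp add: mult.commute)
  show "fps3_summable (subst_terms f (w + var_z * of_nat k))"
    unfolding fps3_summable_def using fps3_sums_subst_terms[OF g] by blast
  have "yz_homogeneous m (of_nat (m choose p) * var_z ^ p * w ^ (m - p) *
      poly (geometric_poly p) (- var_x))" if "p \<le> m" for m p
  proof -
    \<comment> \<open>The degree is written factor by factor; it equals \<open>m\<close> because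
      \<open>p \<le> m\<close> makes the subtraction exact.\<close>
    have "yz_homogeneous (0 + p + (m - p) + 0) (of_nat (m choose p) * var_z ^ p * w ^ (m - p) *
        poly (geometric_poly p) (- var_x))"
      by (intro yz_homogeneous_mult yz_homogeneous_of_nat yz_homogeneous_power_degree_1
          yz_homogeneous_var_z w yz_homogeneous_poly_geometric_poly yz_homogeneous_uminus
          yz_homogeneous_var_x)
    with that show ?thesis by simp
  qed
  then show "fps3_sums R (yz_graded_sum R)"
    unfolding R_def
    by (intro fps3_sums_yz_graded_sum yz_homogeneous_mult_degree_0[OF yz_homogeneous_const3]
        yz_homogeneous_sum) simp
  show "fps3_sums (\<lambda>n. var_x ^ n *
      (\<Sum>k\<le>n. of_nat (n choose k) * (-1) ^ k * fps3_subst f (w + var_z * of_nat k)))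
      (yz_graded_sum R)"
    unfolding fps3_sums_def
  proof (intro allI)
    fix i j l
    let ?T = "\<lambda>n. var_x ^ n *
      (\<Sum>k\<le>n. of_nat (n choose k) * (-1) ^ k * fps3_subst f (w + var_z * of_nat k))"
    have "coeff3 (\<Sum>n<N. ?T n) i j l = coeff3 (yz_graded_sum R) i j l" if "N > j + l" for N
    proof -
      \<comment> \<open>Multiplying by powers of x and by constants leaves the exponents
        \<open>j\<close> and \<open>l\<close> alone, so each f(w + zk) may be replaced by its part
        of degree \<open>j + l\<close>.\<close>
      have "coeff3 (\<Sum>n<N. ?T n) i j l =
          coeff3 (\<Sum>n<N. var_x ^ n * (\<Sum>k\<le>n. of_nat (n choose k) * (-1) ^ k *
            subst_terms f (w + var_z * of_nat k) (j + l))) i j l"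
        by (simp only: coeff3_sum coeff3_var_x_power_mult coeff3_const3_mult
            of_nat_mult_minus_one_power_eq_const3 coeff3_fps3_subst[OF g])
      also have "(\<Sum>n<N. var_x ^ n * (\<Sum>k\<le>n. of_nat (n choose k) * (-1) ^ k *
            subst_terms f (w + var_z * of_nat k) (j + l))) =
          const3 (fps_nth f (j + l)) * (\<Sum>n<N. var_x ^ n * (\<Sum>k\<le>n.
            of_nat (n choose k) * (-1) ^ k * (w + var_z * of_nat k) ^ (j + l)))"
        by (simp only: subst_terms_def sum_distrib_left mult_ac)
      also have "\<dots> = R (j + l)"
        by (simp only: sum_alternating_binomial_power_eq_geometric_poly[OF that] R_def)
      finally show ?thesis by (simp only: coeff3_yz_graded_sum)
    qed
    then show "\<forall>\<^sub>F N in sequentially. coeff3 (\<Sum>n<N. ?T n) i j l = coeff3 (yz_graded_sum R) i j l"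
      using eventually_gt_at_top[of "j + l"] by (rule eventually_mono[rotated])
  qed
qed

theorem theorem2:
  fixes f :: "complex fps"
  shows
    "(\<forall>k. fps3_summable (subst_terms f (var_y + var_z * of_nat k))) \<and>
     fps3_summable (\<lambda>n. var_x ^ n *
       (\<Sum>k\<le>n. of_nat (n choose k) * (-1) ^ k * fps3_subst f (var_y + var_z * of_nat k))) \<and>
     fps3_summable (\<lambda>m. const3 (fps_nth f m) *
       (\<Sum>p\<le>m. of_nat (m choose p) * var_z ^ p * var_y ^ (m - p) * poly (geometric_poly p) (- var_x))) \<and>
     fps3_suminf (\<lambda>n. var_x ^ n *
       (\<Sum>k\<le>n. of_nat (n choose k) * (-1) ^ k * fps3_subst f (var_y + var_z * of_nat k))) =
     fps3_suminf (\<lambda>m. const3 (fps_nth f m) *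
       (\<Sum>p\<le>m. of_nat (m choose p) * var_z ^ p * var_y ^ (m - p) * poly (geometric_poly p) (- var_x))) \<and>
     (\<forall>k. fps3_summable (subst_terms f (var_z * of_nat k))) \<and>
     fps3_summable (\<lambda>n. var_x ^ n *
       (\<Sum>k\<le>n. of_nat (n choose k) * (-1) ^ k * fps3_subst f (var_z * of_nat k))) \<and>
     fps3_summable (\<lambda>m. const3 (fps_nth f m) * var_z ^ m * poly (geometric_poly m) (- var_x)) \<and>
     fps3_suminf (\<lambda>n. var_x ^ n *
       (\<Sum>k\<le>n. of_nat (n choose k) * (-1) ^ k * fps3_subst f (var_z * of_nat k))) =
     fps3_suminf (\<lambda>m. const3 (fps_nth f m) * var_z ^ m * poly (geometric_poly m) (- var_x))"
proof -
  \<comment> \<open>Only \<open>p = m\<close> survives, where \<open>0 ^ 0 = 1\<close>.\<close>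
  have w0: "(\<Sum>p\<le>m. of_nat (m choose p) * var_z ^ p * 0 ^ (m - p) *
      poly (geometric_poly p) (- var_x)) = var_z ^ m * poly (geometric_poly m) (- var_x)" for m
  proof -
    have "(\<Sum>p\<le>m. of_nat (m choose p) * var_z ^ p * 0 ^ (m - p) *
        poly (geometric_poly p) (- var_x)) =
      (\<Sum>p\<le>m. if p = m then var_z ^ m * poly (geometric_poly m) (- var_x) else 0)"
      by (intro sum.cong) auto
    then show ?thesis by simp
  qed
  note y = fps3_sums_geometric_poly[OF yz_homogeneous_var_y, of f]
  \<comment> \<open>The case y = 0 is the instance \<open>w = 0\<close> of the general lemma, not a
    substitution into the first identity.\<close>
  note z = fps3_sums_geometric_poly[OF yz_homogeneous_0, of f,
      unfolded w0 add_0_left mult.assoc[symmetric]]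
  show ?thesis
    using y(1) z(1) fps3_suminf_eq[OF y(2)] fps3_suminf_eq[OF y(3)]
      fps3_suminf_eq[OF z(2)] fps3_suminf_eq[OF z(3)] y(2,3) z(2,3)
    unfolding fps3_summable_def by (intro conjI) (blast | simp)+
qed

end
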